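(* Assume that for every $x\in\mathcal X$ the function $f(x,\cdot)$ is $\mu$-strongly concave on $\mathcal Y$ (no convexity of $f(\cdot,y)$ is assumed) and that $f$ satisfies the Lipschitz gradient assumption with constants $L_{11},L_{12},L_{21},L_{22}>0$. Let $\eta,\rho>0$ and let $\{(x_k,y_k)\}_{k\ge1}$ be generated from $(x_1,y_1)\in\mathcal X\times\mathcal Y$ by $$x_{k+1}=\mathcal P_{\mathcal X}\big(x_k-\tfrac1\eta\nabla_xf(x_k,y_k)\big),\qquad y_{k+1}=\mathcal P_{\mathcal Y}\big(y_k+\rho\nabla_yf(x_{k+1},y_k)\big),\quad k\ge1 .$$ If $\eta>L_{11}$, then for all $k\ge2$, $$f(x_{k+1},y_{k+1})-f(x_k,y_k)\le-\Big(\frac\eta2-\frac{L_{12}^2\rho}{2}\Big)\|x_{k+1}-x_k\|^2-\Big(\frac\mu2-\frac1\rho\Big)\|y_{k+1}-y_k\|^2-\Big(\mu-\frac1{2\rho}-\frac{\rho L_{22}^2}{2}\Big)\|y_k-y_{k-1}\|^2 .$$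
   Context: $\mathcal X\subseteq\mathbb R^n$ and $\mathcal Y\subseteq\mathbb R^m$ are nonempty closed bounded convex sets and $f:\mathcal X\times\mathcal Y\to\mathbb R$ is a smooth function. $\|\cdot\|$ is the Euclidean norm; $\mathcal P_{\mathcal X},\mathcal P_{\mathcal Y}$ are Euclidean projections. Lipschitz gradient assumption: for all $x,\bar x\in\mathcal X$, $y,\bar y\in\mathcal Y$: $\|\nabla_xf(x,y)-\nabla_xf(\bar x,y)\|\le L_{11}\|x-\bar x\|$, $\|\nabla_xf(x,y)-\nabla_xf(x,\bar y)\|\le L_{21}\|y-\bar y\|$, $\|\nabla_yf(x,y)-\nabla_yf(x,\bar y)\|\le L_{22}\|y-\bar y\|$, $\|\nabla_yf(x,y)-\nabla_yf(\bar x,y)\|\le L_{12}\|x-\bar x\|$. A continuously differentiable $\phi$ is $\theta$-strongly convex ($\theta>0$) if $\phi(v)\ge\phi(u)+\langle\nabla\phi(u),v-u\rangle+\frac\theta2\|v-u\|^2$ for all $u,v$, and $\theta$-strongly concave if $-\phi$ is $\theta$-strongly convex. *)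

theory Defs
  imports "HOL-Analysis.Analysis"
begin

text \<open>
  \<open>C1_gradient_on S \<phi> g\<close>: the function \<open>\<phi>\<close> is continuously differentiable on \<open>S\<close> with gradient
  field \<open>g\<close>. The derivative is taken within \<open>S\<close>, so no extension of \<open>\<phi>\<close> beyond \<open>S\<close> is needed; if
  \<open>\<phi>\<close> is continuously differentiable on an open superset of \<open>S\<close>, its ordinary gradient qualifies.
  If \<open>S\<close> has empty interior, \<open>g\<close> need not be unique.
\<close>
definition C1_gradient_on :: "'a::euclidean_space set \<Rightarrow> ('a \<Rightarrow> real) \<Rightarrow> ('a \<Rightarrow> 'a) \<Rightarrow> bool" where
  "C1_gradient_on S \<phi> g \<longleftrightarrow>
     (\<forall>u\<in>S. (\<phi> has_derivative (\<lambda>h. g u \<bullet> h)) (at u within S)) \<and> continuous_on S g"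

definition strongly_convex_on ::
  "real \<Rightarrow> 'a::euclidean_space set \<Rightarrow> ('a \<Rightarrow> real) \<Rightarrow> ('a \<Rightarrow> 'a) \<Rightarrow> bool" where
  "strongly_convex_on \<theta> S \<phi> g \<longleftrightarrow>
     \<theta> > 0 \<and> C1_gradient_on S \<phi> g \<and>
     (\<forall>u\<in>S. \<forall>v\<in>S. \<phi> v \<ge> \<phi> u + g u \<bullet> (v - u) + \<theta> / 2 * (norm (v - u))\<^sup>2)"

definition strongly_concave_on ::
  "real \<Rightarrow> 'a::euclidean_space set \<Rightarrow> ('a \<Rightarrow> real) \<Rightarrow> ('a \<Rightarrow> 'a) \<Rightarrow> bool" where
  "strongly_concave_on \<theta> S \<phi> g \<longleftrightarrow> strongly_convex_on \<theta> S (\<lambda>u. - \<phi> u) (\<lambda>u. - g u)"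

text \<open>
  For a gradient field \<open>G\<close> of a function \<open>f\<close> of a pair \<open>(x, y)\<close>, the partial gradients are the two
  components of \<open>G\<close>, since the inner product of the product space is
  \<open>(a, b) \<bullet> (h, k) = a \<bullet> h + b \<bullet> k\<close>.
\<close>
abbreviation grad_x :: "('a \<times> 'b \<Rightarrow> 'a \<times> 'b) \<Rightarrow> 'a \<Rightarrow> 'b \<Rightarrow> 'a" where
  "grad_x G x y \<equiv> fst (G (x, y))"

abbreviation grad_y :: "('a \<times> 'b \<Rightarrow> 'a \<times> 'b) \<Rightarrow> 'a \<Rightarrow> 'b \<Rightarrow> 'b" where
  "grad_y G x y \<equiv> snd (G (x, y))"

definition lipschitz_gradient ::
  "'a::euclidean_space set \<Rightarrow> 'b::euclidean_space set \<Rightarrow> ('a \<times> 'b \<Rightarrow> 'a \<times> 'b) \<Rightarrow>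
   real \<Rightarrow> real \<Rightarrow> real \<Rightarrow> real \<Rightarrow> bool" where
  "lipschitz_gradient X Y G L11 L12 L21 L22 \<longleftrightarrow>
     (\<forall>x\<in>X. \<forall>x'\<in>X. \<forall>y\<in>Y. \<forall>y'\<in>Y.
        norm (grad_x G x y - grad_x G x' y) \<le> L11 * norm (x - x') \<and>
        norm (grad_x G x y - grad_x G x y') \<le> L21 * norm (y - y') \<and>
        norm (grad_y G x y - grad_y G x y') \<le> L22 * norm (y - y') \<and>
        norm (grad_y G x y - grad_y G x' y) \<le> L12 * norm (x - x'))"

end

theory Submission
  imports Defs
begin

text \<open>
  The step in \<open>x\<close> decreases \<open>f\<close> by the descent lemma. For the step in \<open>y\<close>, with \<open>D\<^sub>k = y\<^bsub>k+1\<^esub> - y\<^sub>k\<close>,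
  strong concavity reduces the claim to a bound on \<open>\<nabla>\<^sub>y f(x\<^bsub>k+1\<^esub>, y\<^sub>k) \<bullet> D\<^sub>k\<close>. The projection inequality
  available against the direction \<open>D\<^sub>k\<close> is that of the previous step, which controls
  \<open>\<nabla>\<^sub>y f(x\<^sub>k, y\<^bsub>k-1\<^esub>) \<bullet> D\<^sub>k\<close> by \<open>(D\<^bsub>k-1\<^esub> \<bullet> D\<^sub>k) / \<rho>\<close>. The change of the gradient in \<open>x\<close> is absorbed by
  Young's inequality; its change \<open>q\<close> in \<open>y\<close> is tested with \<open>D\<^sub>k = D\<^bsub>k-1\<^esub> + (D\<^sub>k - D\<^bsub>k-1\<^esub>)\<close>, where strong
  monotonicity handles \<open>q \<bullet> D\<^bsub>k-1\<^esub>\<close> and the Young term in \<open>\<parallel>D\<^sub>k - D\<^bsub>k-1\<^esub>\<parallel>\<^sup>2\<close> cancels against the one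
  produced by polarizing \<open>D\<^bsub>k-1\<^esub> \<bullet> D\<^sub>k\<close>.
\<close>

text \<open>The mean value theorem on the segment from \<open>u\<close> to \<open>v\<close>; at the
  intermediate point, Cauchy-Schwarz and the Lipschitz bound control the change of the
  gradient.\<close>

lemma descent_lemma:
  fixes \<phi> :: "'a::real_inner \<Rightarrow> real"
  assumes "convex S" "u \<in> S" "v \<in> S"
    and deriv: "\<And>w. w \<in> S \<Longrightarrow> (\<phi> has_derivative (\<lambda>h. g w \<bullet> h)) (at w within S)"
    and lip: "\<And>w. w \<in> S \<Longrightarrow> norm (g w - g u) \<le> L * norm (w - u)"
  shows "\<phi> v \<le> \<phi> u + g u \<bullet> (v - u) + L / 2 * (norm (v - u))\<^sup>2"
proof -
  define e where "e = v - u"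
  define p where "p = (\<lambda>t::real. u + t *\<^sub>R e)"
  \<comment> \<open>The terms of the bound are subtracted along the segment, so the claim reads
    \<open>\<psi> 1 \<le> \<psi> 0\<close>.\<close>
  define \<psi> where "\<psi> = (\<lambda>t. \<phi> (p t) - t * (g u \<bullet> e) - L / 2 * (norm e)\<^sup>2 * t\<^sup>2)"
  have p_in: "p t \<in> S" if "t \<in> {0..1}" for t
    using convexD_alt[OF assms(1-3), of t] that
    by (simp add: p_def e_def algebra_simps)
  have deriv_psi: "(\<psi> has_derivative (\<lambda>h. g (p t) \<bullet> (h *\<^sub>R e) - h * (g u \<bullet> e) - L * (norm e)\<^sup>2 * t * h))
      (at t within {0..1})" if "0 \<le> t" "t \<le> 1" for t
  proof -
    have "(p has_derivative (\<lambda>h. h *\<^sub>R e)) (at t within {0..1})"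
      unfolding p_def by (auto intro!: derivative_eq_intros)
    moreover have "(\<phi> has_derivative (\<lambda>h. g (p t) \<bullet> h)) (at (p t) within p ` {0..1})"
      using that p_in by (intro has_derivative_subset[OF deriv]) auto
    ultimately have "((\<lambda>t. \<phi> (p t)) has_derivative (\<lambda>h. g (p t) \<bullet> (h *\<^sub>R e))) (at t within {0..1})"
      by (rule has_derivative_in_compose)
    then show ?thesis
      unfolding \<psi>_def by (auto intro!: derivative_eq_intros simp: algebra_simps)
  qed
  obtain t where t: "0 < t" "t < 1"
    and "\<psi> 1 - \<psi> 0 = g (p t) \<bullet> e - g u \<bullet> e - L * (norm e)\<^sup>2 * t"
    using mvt_simple[OF zero_less_one deriv_psi] by auto
  moreover have "(g (p t) - g u) \<bullet> e \<le> L * (norm e)\<^sup>2 * t"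
  proof -
    have "(g (p t) - g u) \<bullet> e \<le> norm (g (p t) - g u) * norm e"
      by (rule norm_cauchy_schwarz)
    also have "\<dots> \<le> (L * norm (p t - u)) * norm e"
      using t lip p_in by (intro mult_right_mono) auto
    finally show ?thesis
      using t by (simp add: p_def power2_eq_square mult_ac)
  qed
  ultimately have "\<psi> 1 \<le> \<psi> 0"
    by (simp add: inner_diff_left)
  then show ?thesis
    by (simp add: \<psi>_def p_def e_def)
qed

text \<open>Expand the square of \<open>norm (\<rho> *\<^sub>R a - b)\<close>. The bound
  \<open>c\<close> leaves room for a Lipschitz estimate of \<open>norm a\<close>.\<close>

lemma young_inner:
  fixes a b :: "'a::real_inner"
  assumes "\<rho> > 0" "norm a \<le> c"
  shows "a \<bullet> b \<le> \<rho> / 2 * c\<^sup>2 + (norm b)\<^sup>2 / (2 * \<rho>)"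
proof -
  have "0 \<le> (norm (\<rho> *\<^sub>R a - b))\<^sup>2 / (2 * \<rho>)"
    using assms by simp
  also have "\<dots> = \<rho> / 2 * (norm a)\<^sup>2 + (norm b)\<^sup>2 / (2 * \<rho>) - a \<bullet> b"
    using assms(1)
    by (simp add: power2_norm_eq_inner inner_diff inner_commute field_simps)
  moreover have "\<rho> / 2 * (norm a)\<^sup>2 \<le> \<rho> / 2 * c\<^sup>2"
    using assms by (intro mult_left_mono power_mono) auto
  ultimately show ?thesis
    by linarith
qed

text \<open>Variational inequality of the projection. The sign of \<open>c\<close> is free, which
  covers both the descent step in \<open>x\<close> and the ascent step in \<open>y\<close>.\<close>

lemma closest_point_step:
  assumes "convex S" "closed S" "z \<in> S" and "p = closest_point S (u + c *\<^sub>R g)"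
  shows "c * (g \<bullet> (z - p)) \<le> (p - u) \<bullet> (z - p)"
  using closest_point_dot[OF assms(1-3), of "u + c *\<^sub>R g"] assms(4)
  by (simp add: inner_diff_left inner_add_left)

lemma strongly_concave_on_le:
  assumes "strongly_concave_on \<mu> S \<phi> g" "u \<in> S" "v \<in> S"
  shows "\<phi> v \<le> \<phi> u + g u \<bullet> (v - u) - \<mu> / 2 * (norm (v - u))\<^sup>2"
  using assms unfolding strongly_concave_on_def strongly_convex_on_def by fastforce

text \<open>Add the strong concavity inequalities at \<open>u\<close> and at \<open>v\<close>; the
  function values cancel.\<close>

lemma strongly_concave_on_gradient_monotone:
  assumes "strongly_concave_on \<mu> S \<phi> g" "u \<in> S" "v \<in> S"
  shows "(g v - g u) \<bullet> (v - u) \<le> - \<mu> * (norm (v - u))\<^sup>2"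
  using strongly_concave_on_le[OF assms] strongly_concave_on_le[OF assms(1,3,2)]
  by (simp add: norm_minus_commute algebra_simps)

lemma C1_gradient_on_partial_x:
  fixes f :: "'a::euclidean_space \<times> 'b::euclidean_space \<Rightarrow> real"
  assumes "C1_gradient_on (X \<times> Y) f G" "x \<in> X" "y \<in> Y"
  shows "((\<lambda>u. f (u, y)) has_derivative (\<lambda>h. grad_x G x y \<bullet> h)) (at x within X)"
proof -
  have "((\<lambda>u. (u, y)) has_derivative (\<lambda>h. (h, 0))) (at x within X)"
    by (auto intro!: derivative_eq_intros)
  moreover have "(f has_derivative (\<lambda>h. G (x, y) \<bullet> h)) (at (x, y) within (\<lambda>u. (u, y)) ` X)"
    using assms unfolding C1_gradient_on_def
    by (blast intro: has_derivative_subset[of _ _ _ "X \<times> Y"])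
  ultimately have "((\<lambda>u. f (u, y)) has_derivative (\<lambda>h. G (x, y) \<bullet> (h, 0))) (at x within X)"
    by (rule has_derivative_in_compose)
  then show ?thesis
    by (simp add: inner_prod_def)
qed

theorem lemma3p1:
  fixes X :: "(real ^ 'n) set" and Y :: "(real ^ 'm) set"
    and f :: "(real ^ 'n) \<times> (real ^ 'm) \<Rightarrow> real"
    and G :: "(real ^ 'n) \<times> (real ^ 'm) \<Rightarrow> (real ^ 'n) \<times> (real ^ 'm)"
    and x :: "nat \<Rightarrow> real ^ 'n" and y :: "nat \<Rightarrow> real ^ 'm"
    and L11 L12 L21 L22 \<mu> \<eta> \<rho> :: real
  assumes "X \<noteq> {}" "closed X" "bounded X" "convex X"
    and "Y \<noteq> {}" "closed Y" "bounded Y" "convex Y"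
    and "C1_gradient_on (X \<times> Y) f G"
    and "\<forall>u\<in>X. strongly_concave_on \<mu> Y (\<lambda>v. f (u, v)) (\<lambda>v. grad_y G u v)"
    and "L11 > 0" "L12 > 0" "L21 > 0" "L22 > 0"
    and "lipschitz_gradient X Y G L11 L12 L21 L22"
    and "\<eta> > 0" "\<rho> > 0"
    and "x 1 \<in> X" "y 1 \<in> Y"
    and "\<forall>k\<ge>1. x (k + 1) = closest_point X (x k - (1 / \<eta>) *\<^sub>R grad_x G (x k) (y k))"
    and "\<forall>k\<ge>1. y (k + 1) = closest_point Y (y k + \<rho> *\<^sub>R grad_y G (x (k + 1)) (y k))"
    and "\<eta> > L11"
  shows "\<forall>k\<ge>2. f (x (k + 1), y (k + 1)) - f (x k, y k)
    \<le> - (\<eta> / 2 - L12\<^sup>2 * \<rho> / 2) * (norm (x (k + 1) - x k))\<^sup>2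
      - (\<mu> / 2 - 1 / \<rho>) * (norm (y (k + 1) - y k))\<^sup>2
      - (\<mu> - 1 / (2 * \<rho>) - \<rho> * L22\<^sup>2 / 2) * (norm (y k - y (k - 1)))\<^sup>2"
proof (intro allI impI)
  fix k :: nat
  assume k: "k \<ge> 2"
  have xy_mem: "x i \<in> X \<and> y i \<in> Y" if "i \<ge> 1" for i
    using that
  proof (induction i rule: dec_induct)
    case base
    then show ?case using assms(18,19) by simp
  next
    case (step i)
    then show ?case
      using assms(20,21) closest_point_in_set[OF assms(2,1)] closest_point_in_set[OF assms(6,5)]
      by simp
  qed
  \<comment> \<open>Iterates are controlled from index 1 on, so \<open>y (k - 1) \<in> Y\<close>
    relies on \<open>k \<ge> 2\<close>.\<close>
  have mem: "x k \<in> X" "x (k + 1) \<in> X" "y (k - 1) \<in> Y" "y k \<in> Y" "y (k + 1) \<in> Y"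
    using xy_mem k by auto
  define e D d where "e = x (k + 1) - x k" and "D = y (k + 1) - y k" and "d = y k - y (k - 1)"
  define q where "q = grad_y G (x k) (y k) - grad_y G (x k) (y (k - 1))"
  define r where "r = grad_y G (x (k + 1)) (y k) - grad_y G (x k) (y k)"
  note lip = assms(15)[unfolded lipschitz_gradient_def, rule_format]

  have "f (x (k + 1), y k) \<le> f (x k, y k) + grad_x G (x k) (y k) \<bullet> e + L11 / 2 * (norm e)\<^sup>2"
    unfolding e_def using mem C1_gradient_on_partial_x[OF assms(9)] lip
    by (intro descent_lemma[OF assms(4)]) auto
  \<comment> \<open>The projection inequality is tested at the old iterate \<open>x k\<close>, where
    \<open>z - p\<close> is \<open>- e\<close>.\<close>
  moreover have "grad_x G (x k) (y k) \<bullet> e \<le> - \<eta> * (norm e)\<^sup>2"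
  proof -
    have "x (k + 1) = closest_point X (x k + (- 1 / \<eta>) *\<^sub>R grad_x G (x k) (y k))"
      using assms(20) k by simp
    from closest_point_step[OF assms(4,2) mem(1) this]
    have "- 1 / \<eta> * (grad_x G (x k) (y k) \<bullet> (- e)) \<le> e \<bullet> (- e)"
      by (simp add: e_def)
    then show ?thesis
      using assms(16) by (simp add: power2_norm_eq_inner field_simps)
  qed
  \<comment> \<open>Half of the decrease \<open>\<eta> * (norm e)\<^sup>2\<close> pays for the
    curvature term.\<close>
  moreover have "L11 / 2 * (norm e)\<^sup>2 \<le> \<eta> / 2 * (norm e)\<^sup>2"
    using assms(22) by (intro mult_right_mono) auto
  ultimately have x_step: "f (x (k + 1), y k) - f (x k, y k) \<le> - (\<eta> / 2) * (norm e)\<^sup>2"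
    by (simp add: field_simps)

  have y_step: "f (x (k + 1), y (k + 1)) - f (x (k + 1), y k)
      \<le> grad_y G (x (k + 1)) (y k) \<bullet> D - \<mu> / 2 * (norm D)\<^sup>2"
    using strongly_concave_on_le[OF assms(10)[rule_format, OF mem(2)] mem(4,5)]
    by (simp add: D_def)
  have split: "grad_y G (x (k + 1)) (y k) \<bullet> D
      = r \<bullet> D + q \<bullet> (D - d) + q \<bullet> d + grad_y G (x k) (y (k - 1)) \<bullet> D"
    by (simp add: r_def q_def inner_diff)
  have rD: "r \<bullet> D \<le> \<rho> / 2 * (L12 * norm e)\<^sup>2 + (norm D)\<^sup>2 / (2 * \<rho>)"
    using young_inner[OF assms(17), of r] lip mem by (auto simp: r_def e_def)
  have qv: "q \<bullet> (D - d) \<le> \<rho> / 2 * (L22 * norm d)\<^sup>2 + (norm (D - d))\<^sup>2 / (2 * \<rho>)"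
    using young_inner[OF assms(17), of q] lip mem by (auto simp: q_def d_def)
  have qd: "q \<bullet> d \<le> - \<mu> * (norm d)\<^sup>2"
    unfolding q_def d_def
    using strongly_concave_on_gradient_monotone[OF assms(10)[rule_format, OF mem(1)] mem(3,4)] .
  \<comment> \<open>The projection that produced \<open>y k\<close> is tested at the later iterate
    \<open>y (k + 1)\<close>; its gradient already uses \<open>x k\<close>, by the alternating order
    of the updates.\<close>
  have prev: "grad_y G (x k) (y (k - 1)) \<bullet> D
      \<le> ((norm d)\<^sup>2 + (norm D)\<^sup>2 - (norm (D - d))\<^sup>2) / (2 * \<rho>)"
  proof -
    have "y k = closest_point Y (y (k - 1) + \<rho> *\<^sub>R grad_y G (x k) (y (k - 1)))"
      using assms(21)[rule_format, of "k - 1"] k by simp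
    from closest_point_step[OF assms(8,6) mem(5) this]
    have "\<rho> * (grad_y G (x k) (y (k - 1)) \<bullet> D) \<le> d \<bullet> D"
      by (simp add: d_def D_def)
    also have "d \<bullet> D = ((norm d)\<^sup>2 + (norm D)\<^sup>2 - (norm (D - d))\<^sup>2) / 2"
      by (simp add: power2_norm_eq_inner inner_diff inner_commute)
    finally show ?thesis
      using assms(17) by (simp add: field_simps)
  qed

  have "f (x (k + 1), y (k + 1)) - f (x k, y k)
      \<le> - (\<eta> / 2) * (norm e)\<^sup>2 - \<mu> / 2 * (norm D)\<^sup>2
        + (\<rho> / 2 * (L12 * norm e)\<^sup>2 + (norm D)\<^sup>2 / (2 * \<rho>))
        + (\<rho> / 2 * (L22 * norm d)\<^sup>2 + (norm (D - d))\<^sup>2 / (2 * \<rho>))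
        - \<mu> * (norm d)\<^sup>2 + ((norm d)\<^sup>2 + (norm D)\<^sup>2 - (norm (D - d))\<^sup>2) / (2 * \<rho>)"
    using x_step y_step split rD qv qd prev by linarith
  also have "\<dots> = - (\<eta> / 2 - L12\<^sup>2 * \<rho> / 2) * (norm e)\<^sup>2 - (\<mu> / 2 - 1 / \<rho>) * (norm D)\<^sup>2
      - (\<mu> - 1 / (2 * \<rho>) - \<rho> * L22\<^sup>2 / 2) * (norm d)\<^sup>2"
    using assms(17) by (simp add: field_simps)
  finally show "f (x (k + 1), y (k + 1)) - f (x k, y k)
    \<le> - (\<eta> / 2 - L12\<^sup>2 * \<rho> / 2) * (norm (x (k + 1) - x k))\<^sup>2
      - (\<mu> / 2 - 1 / \<rho>) * (norm (y (k + 1) - y k))\<^sup>2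
      - (\<mu> - 1 / (2 * \<rho>) - \<rho> * L22\<^sup>2 / 2) * (norm (y k - y (k - 1)))\<^sup>2"
    by (simp only: e_def D_def d_def)
qed

end
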